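(* Consider the one-dimensional fully-discrete forward Euler nodal DG scheme described in the context. It is positivity-preserving in the following sense: if $\mathbf U_{i_1}^{i,n}\in\mathscr G$ for all $i,i_1$, then $\bar{\mathbf U}^{i,n+1}\in\mathscr G$ for all $i$, under the time step restriction $$\Delta t<\min\Big\{\frac{\omega_0}{4\alpha_0}\Delta x,\ \min_{i,i_1}\{t_{i_1}^{s,i}\}\Big\},\qquad \alpha_0=\max_\Omega\{|u|+c\},\quad c=\sqrt{\gamma p/\rho},$$ where, writing $\mathbf S_{i_1}^{0,i}=(\Theta_{1,i_1}^i,\Theta_{2,i_1}^i,\Theta_{3,i_1}^i)^T$, $$t_{i_1}^{s,i}=\begin{cases}\dfrac12\min\Big\{\dfrac{B+\sqrt{B^2+4AC}}{2A},\ \dfrac{(1-K)\rho_{i_1}^i}{|\Theta_{1,i_1}^i|}\Big\},&\Theta_{1,i_1}^i\ne0,\\[2mm]\dfrac{B+\sqrt{B^2+4AC}}{4A},&\Theta_{1,i_1}^i=0,\end{cases}$$ and, at each node (omitting $i,i_1$, all quantities evaluated at time level $n$), $$A=\frac1{2K\rho}(\Theta_2-\rho\phi_x)^2,\quad B=\Theta_3-m\phi_x-\frac1K(u\Theta_2-m\phi_x),\quad C=\frac p{\gamma-1}-\frac{1-K}{2K\rho}m^2,$$ $$K=\frac{1+\tilde K}2,\qquad \tilde K=\frac{(\gamma-1)m^2}{(\gamma-1)m^2+\rho p}$$ (with $A\neq 0$ at each node, so that $t_{i_1}^{s,i}$ is defined).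
   Context: **Equations.** 1D Euler equations with gravity $\mathbf U_t+\mathbf F(\mathbf U)_x=\mathbf S(\mathbf U,x)$ on $\Omega=[a,b]$, $\mathbf U=(\rho,m,\mathcal E)^T$, $m=\rho u$, $\mathbf F(\mathbf U)=(m,\rho u^2+p,u(\mathcal E+p))^T$, $\mathbf S(\mathbf U,x)=(0,-\rho\phi_x,-m\phi_x)^T$, with given time-independent potential $\phi(x)$ and $\mathcal E=\frac p{\gamma-1}+\frac12\rho u^2$, $\gamma=1.4$. Admissible set: $\mathscr G=\{(\rho,m,\mathcal E):\rho>0,\ p>0\}$. With $s=\ln(p\rho^{-\gamma})$, the entropy variable is $\mathbf V(\mathbf U)=\big(\frac{\gamma-s}{\gamma-1}-\frac{\rho u^2}{2p},\ \frac{\rho u}{p},\ -\frac{\rho}{p}\big)^T$ and the potential flux is $\psi=\rho u$. **Equilibrium.** $\mathbf U^e=(\rho^e,m^e,\mathcal E^e)^T:\Omega\to\mathscr G$ is a given (classical) steady state: $\mathbf F(\mathbf U^e)_x=\mathbf S(\mathbf U^e,x)$. **Discretization.** $\Omega$ is split into $N$ uniform cells $K_i=[x_{i-1/2},x_{i+1/2}]$ of length $\Delta x$ and center $x_i$. $-1=X_0<\dots<X_k=1$ ($k\ge1$) are the Gauss–Lobatto points on $[-1,1]$ with quadrature weights $\omega_0,\dots,\omega_k$; $L_l$ are the Lagrange basis polynomials at these points; $D_{jl}=L_l'(X_j)$; $\tau_0=-1$, $\tau_k=1$, $\tau_j=0$ otherwise. $x_i(X)=x_i+\frac{\Delta x}2X$.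 The unknown $\mathbf U_h$ is piecewise polynomial of degree $\le k$, determined by nodal values $\mathbf U_{i_1}^i=\mathbf U_h|_{K_i}(x_i(X_{i_1}))$; $\mathbf U_{i_1}^{e,i}=\mathbf U^e(x_i(X_{i_1}))$; $\mathbf F_{i_1}^i=\mathbf F(\mathbf U_{i_1}^i)$. $\mathbf F^S(\mathbf U_L,\mathbf U_R)$ is an entropy conservative flux: consistent ($\mathbf F^S(\mathbf U,\mathbf U)=\mathbf F(\mathbf U)$), symmetric, and $(\mathbf V_R-\mathbf V_L)^T\mathbf F^S(\mathbf U_L,\mathbf U_R)=\psi_R-\psi_L$. $\hat{\mathbf F}(\mathbf U_L,\mathbf U_R)=\frac12(\mathbf F(\mathbf U_L)+\mathbf F(\mathbf U_R))-\frac\alpha2(\mathbf U_R-\mathbf U_L)$ is the Lax–Friedrichs flux with $\alpha=\max\{|u_L|+c_L,|u_R|+c_R,\alpha^{RRF}(\mathbf U_L,\mathbf U_R)\}$, where $\alpha^{RRF}$ is the two-rarefaction wave-speed estimate: $p^*=\Big(\frac{\max\{c_L+c_R-\frac{\gamma-1}2(u_R-u_L),0\}}{c_Lp_L^{-(\gamma-1)/(2\gamma)}+c_Rp_R^{-(\gamma-1)/(2\gamma)}}\Big)^{2\gamma/(\gamma-1)}$, $q_{Z}=\sqrt{1+\frac{\gamma+1}{2\gamma}\max\{p^*/p_{Z}-1,0\}}$ for $Z\in\{L,R\}$, $\alpha^{RRF}=\max\{|u_L-c_Lq_L|,|u_R+c_Rq_R|\}$. $\hat{\mathbf F}_{i+1/2}=\hat{\mathbf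 F}(\mathbf U_k^i,\mathbf U_0^{i+1})$; $\mathbf F_0^{*,i}=\hat{\mathbf F}_{i-1/2}$, $\mathbf F_k^{*,i}=\hat{\mathbf F}_{i+1/2}$, $\mathbf F_{i_1}^{*,i}=0$ for $0<i_1<k$. The maximum $\alpha_0$ is taken over the values of the numerical solution at time level $n$ at all nodes (including the exterior boundary states $\mathbf U_k^0,\mathbf U_0^{N+1}$, which are also assumed in $\mathscr G$). **Scheme.** The semi-discrete scheme $\frac{\mathrm d\mathbf U_h}{\mathrm dt}=\mathcal L_h(\mathbf U_h)$ is: for all $i,i_1$, $$\frac{\mathrm d\mathbf U_{i_1}^i}{\mathrm dt}+\frac2{\Delta x}\sum_{l=0}^k2D_{i_1,l}\mathbf F^S(\mathbf U_{i_1}^i,\mathbf U_l^i)+\frac2{\Delta x}\frac{\tau_{i_1}}{\omega_{i_1}}(\mathbf F_{i_1}^{*,i}-\mathbf F_{i_1}^i)=\mathbf S_{i_1}^i+\mathbf S_{i_1}^{0,i}-\mathbf S_{i_1}^{corr,i},$$ where, with $\phi_{x,i_1}^i=\phi_x(x_i(X_{i_1}))$, $\mathbf S_{i_1}^i=(0,-\rho_{i_1}^i\phi_{x,i_1}^i,-m_{i_1}^i\phi_{x,i_1}^i)^T$, $\mathbf S_{i_1}^{e,i}=(0,-\rho_{i_1}^{e,i}\phi_{x,i_1}^i,-m_{i_1}^{e,i}\phi_{x,i_1}^i)^T$, $$\mathbf S_{i_1}^{0,i}=\frac2{\Delta x}\sum_{l=0}^k2D_{i_1,l}\mathbf F^S(\mathbf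 U_{i_1}^{e,i},\mathbf U_l^{e,i})-\mathbf S_{i_1}^{e,i},\qquad \mathbf S_{i_1}^{corr,i}=\sigma_i(\mathbf V_{i_1}^i-\bar{\mathbf V}^i),$$ $$\sigma_i=\frac{\sum_{i_1=0}^k\omega_{i_1}(\mathbf V_{i_1}^i-\mathbf V_{i_1}^{e,i})^T\mathbf S_{i_1}^{0,i}}{\sum_{i_1=0}^k\omega_{i_1}\|\mathbf V_{i_1}^i-\bar{\mathbf V}^i\|^2},\quad \mathbf V_{i_1}^i=\mathbf V(\mathbf U_{i_1}^i),\ \mathbf V_{i_1}^{e,i}=\mathbf V(\mathbf U_{i_1}^{e,i}),\ \bar{\mathbf V}^i=\sum_{i_1=0}^k\frac{\omega_{i_1}}2\mathbf V_{i_1}^i;$$ if the denominator of $\sigma_i$ is zero, $\mathbf S_{i_1}^{corr,i}=\mathbf 0$. **Fully-discrete scheme.** $\mathbf U_h^{EF}=\mathbf U_h^n+\Delta t\,\mathcal L_h(\mathbf U_h^n)$. The cell average at the new time level is $\bar{\mathbf U}^{i,n+1}=\sum_{i_1=0}^k\frac{\omega_{i_1}}2\mathbf U_{i_1}^{i,EF}$ (a subsequent scaling limiter may be applied, which leaves cell averages unchanged).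
   Formalization: Besides the stated restriction, the time step must satisfy Δt ≤ ω₀Δx/(4α) at every interface, α being the Lax–Friedrichs viscosity used there; α^RRF can exceed α₀, and then the claim as stated fails (the density can become negative). *)

theory Defs
  imports "HOL-Analysis.Analysis" "HOL-Computational_Algebra.Polynomial"
begin

section \<open>Compressible Euler equations with gravity in one dimension\<close>

text \<open>
  A state is the vector of conserved variables: density, momentum, total energy.
\<close>

type_synonym state = "real ^ 3"

definition gam :: real where
  "gam = 7 / 5"

definition dens :: "state \<Rightarrow> real" where
  "dens U = U $ 1"

definition mom :: "state \<Rightarrow> real" where
  "mom U = U $ 2"

definition energy :: "state \<Rightarrow> real" where
  "energy U = U $ 3"

definition vel :: "state \<Rightarrow> real" where
  "vel U = mom U / dens U"

text \<open>The ideal gas law \<open>energy = p / (gam - 1) + dens * vel\<^sup>2 / 2\<close>, solved for \<open>p\<close>.\<close>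

definition pres :: "state \<Rightarrow> real" where
  "pres U = (gam - 1) * (energy U - dens U * (vel U)\<^sup>2 / 2)"

definition sound :: "state \<Rightarrow> real" where
  "sound U = sqrt (gam * pres U / dens U)"

definition admissible :: "state set" where
  "admissible = {U. dens U > 0 \<and> pres U > 0}"

definition euler_flux :: "state \<Rightarrow> state" where
  "euler_flux U = vector [mom U, dens U * (vel U)\<^sup>2 + pres U, vel U * (energy U + pres U)]"

text \<open>In \<open>grav_source U g\<close> the number \<open>g\<close> is the value of the derivative of the potential.\<close>

definition grav_source :: "state \<Rightarrow> real \<Rightarrow> state" where
  "grav_source U g = vector [0, - dens U * g, - mom U * g]"

definition spec_entropy :: "state \<Rightarrow> real" where
  "spec_entropy U = ln (pres U * dens U powr (- gam))"

definition entropy_var :: "state \<Rightarrow> state" where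
  "entropy_var U = vector
     [(gam - spec_entropy U) / (gam - 1) - dens U * (vel U)\<^sup>2 / (2 * pres U),
      dens U * vel U / pres U,
      - dens U / pres U]"

definition potential_flux :: "state \<Rightarrow> real" where
  "potential_flux U = dens U * vel U"

text \<open>
  Classical steady state on \<open>[a,b]\<close> with values in the admissible set; derivatives at the end
  points are one-sided.
\<close>

definition steady_state :: "real \<Rightarrow> real \<Rightarrow> (real \<Rightarrow> real) \<Rightarrow> (real \<Rightarrow> state) \<Rightarrow> bool" where
  "steady_state a b phix Ue \<longleftrightarrow>
     (\<forall>x\<in>{a..b}. Ue x \<in> admissible \<and>
        ((\<lambda>y. euler_flux (Ue y)) has_vector_derivative grav_source (Ue x) (phix x))
          (at x within {a..b}))"

section \<open>Numerical fluxes\<close>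

definition entropy_conservative_flux :: "(state \<Rightarrow> state \<Rightarrow> state) \<Rightarrow> bool" where
  "entropy_conservative_flux FS \<longleftrightarrow>
     (\<forall>U\<in>admissible. FS U U = euler_flux U) \<and>
     (\<forall>UL\<in>admissible. \<forall>UR\<in>admissible. FS UL UR = FS UR UL) \<and>
     (\<forall>UL\<in>admissible. \<forall>UR\<in>admissible.
        (entropy_var UR - entropy_var UL) \<bullet> FS UL UR = potential_flux UR - potential_flux UL)"

text \<open>Two-rarefaction estimate of the intermediate pressure and of the wave speeds.\<close>

definition p_star :: "state \<Rightarrow> state \<Rightarrow> real" where
  "p_star UL UR =
     (max (sound UL + sound UR - (gam - 1) / 2 * (vel UR - vel UL)) 0
      / (sound UL * pres UL powr (- ((gam - 1) / (2 * gam)))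
         + sound UR * pres UR powr (- ((gam - 1) / (2 * gam)))))
     powr (2 * gam / (gam - 1))"

definition q_factor :: "real \<Rightarrow> state \<Rightarrow> real" where
  "q_factor ps U = sqrt (1 + (gam + 1) / (2 * gam) * max (ps / pres U - 1) 0)"

definition alpha_RRF :: "state \<Rightarrow> state \<Rightarrow> real" where
  "alpha_RRF UL UR =
     max \<bar>vel UL - sound UL * q_factor (p_star UL UR) UL\<bar>
         \<bar>vel UR + sound UR * q_factor (p_star UL UR) UR\<bar>"

definition lf_alpha :: "state \<Rightarrow> state \<Rightarrow> real" where
  "lf_alpha UL UR =
     max (max (\<bar>vel UL\<bar> + sound UL) (\<bar>vel UR\<bar> + sound UR)) (alpha_RRF UL UR)"

definition lf_flux :: "state \<Rightarrow> state \<Rightarrow> state" where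
  "lf_flux UL UR =
     (1 / 2) *\<^sub>R (euler_flux UL + euler_flux UR) - (lf_alpha UL UR / 2) *\<^sub>R (UR - UL)"

section \<open>Gauss--Lobatto quadrature and the difference matrix\<close>

text \<open>Rodrigues' formula.\<close>

definition legendre :: "nat \<Rightarrow> real poly" where
  "legendre n = smult (1 / (2 ^ n * fact n)) ((pderiv ^^ n) ([:-1, 0, 1:] ^ n))"

definition lagrange_basis :: "nat \<Rightarrow> (nat \<Rightarrow> real) \<Rightarrow> nat \<Rightarrow> real poly" where
  "lagrange_basis k X l = (\<Prod>j\<in>{..k} - {l}. smult (1 / (X l - X j)) [:- X j, 1:])"

text \<open>
  The \<open>k + 1\<close> Gauss--Lobatto points are the two end points of \<open>[-1,1]\<close> and the zeros of the derivative
  of the Legendre polynomial of degree \<open>k\<close>; the weights are those of the interpolatory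
  quadrature rule.
\<close>

definition gauss_lobatto :: "nat \<Rightarrow> (nat \<Rightarrow> real) \<Rightarrow> (nat \<Rightarrow> real) \<Rightarrow> bool" where
  "gauss_lobatto k X w \<longleftrightarrow>
     X 0 = -1 \<and> X k = 1 \<and> strict_mono_on {..k} X \<and>
     (\<forall>j. 0 < j \<and> j < k \<longrightarrow> poly (pderiv (legendre k)) (X j) = 0) \<and>
     (\<forall>j\<le>k. w j = integral {-1..1} (poly (lagrange_basis k X j)))"

definition diff_mat :: "nat \<Rightarrow> (nat \<Rightarrow> real) \<Rightarrow> nat \<Rightarrow> nat \<Rightarrow> real" where
  "diff_mat k X j l = poly (pderiv (lagrange_basis k X l)) (X j)"

definition tau :: "nat \<Rightarrow> nat \<Rightarrow> real" where
  "tau k j = (if j = 0 then -1 else if j = k then 1 else 0)"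

section \<open>Semi-discrete scheme\<close>

text \<open>
  Cells are numbered \<open>1, \<dots>, N\<close>. A piecewise polynomial of degree at most \<open>k\<close> is represented by its
  nodal values \<open>U i j\<close> (cell \<open>i\<close>, node \<open>j \<le> k\<close>). The entries \<open>U 0 k\<close> and \<open>U (N + 1) 0\<close> hold the
  exterior boundary states; other entries outside the cells \<open>1, \<dots>, N\<close> are never used.
\<close>

text \<open>The point \<open>x\<^sub>i(X\<^sub>j)\<close>; the center of cell \<open>i\<close> is \<open>a + (i - 1/2) dx\<close>.\<close>

definition node :: "real \<Rightarrow> real \<Rightarrow> (nat \<Rightarrow> real) \<Rightarrow> nat \<Rightarrow> nat \<Rightarrow> real" where
  "node a dx X i j = (a + (real i - 1 / 2) * dx) + dx / 2 * X j"

definition surface_flux :: "nat \<Rightarrow> (nat \<Rightarrow> nat \<Rightarrow> state) \<Rightarrow> nat \<Rightarrow> nat \<Rightarrow> state" where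
  "surface_flux k U i j =
     (if j = 0 then lf_flux (U (i - 1) k) (U i 0)
      else if j = k then lf_flux (U i k) (U (i + 1) 0)
      else 0)"

definition source0 ::
  "nat \<Rightarrow> (nat \<Rightarrow> real) \<Rightarrow> real \<Rightarrow> real \<Rightarrow> (state \<Rightarrow> state \<Rightarrow> state) \<Rightarrow> (real \<Rightarrow> real) \<Rightarrow> (real \<Rightarrow> state)
   \<Rightarrow> nat \<Rightarrow> nat \<Rightarrow> state" where
  "source0 k X a dx FS phix Ue i j =
     (2 / dx) *\<^sub>R (\<Sum>l\<le>k. (2 * diff_mat k X j l) *\<^sub>R
                      FS (Ue (node a dx X i j)) (Ue (node a dx X i l)))
     - grav_source (Ue (node a dx X i j)) (phix (node a dx X i j))"

definition V_bar :: "nat \<Rightarrow> (nat \<Rightarrow> real) \<Rightarrow> (nat \<Rightarrow> nat \<Rightarrow> state) \<Rightarrow> nat \<Rightarrow> state" where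
  "V_bar k w U i = (\<Sum>j\<le>k. (w j / 2) *\<^sub>R entropy_var (U i j))"

definition sigma_denom :: "nat \<Rightarrow> (nat \<Rightarrow> real) \<Rightarrow> (nat \<Rightarrow> nat \<Rightarrow> state) \<Rightarrow> nat \<Rightarrow> real" where
  "sigma_denom k w U i = (\<Sum>j\<le>k. w j * (norm (entropy_var (U i j) - V_bar k w U i))\<^sup>2)"

definition sigma ::
  "nat \<Rightarrow> (nat \<Rightarrow> real) \<Rightarrow> (nat \<Rightarrow> real) \<Rightarrow> real \<Rightarrow> real \<Rightarrow> (state \<Rightarrow> state \<Rightarrow> state) \<Rightarrow> (real \<Rightarrow> real)
   \<Rightarrow> (real \<Rightarrow> state) \<Rightarrow> (nat \<Rightarrow> nat \<Rightarrow> state) \<Rightarrow> nat \<Rightarrow> real" where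
  "sigma k X w a dx FS phix Ue U i =
     (\<Sum>j\<le>k. w j * ((entropy_var (U i j) - entropy_var (Ue (node a dx X i j)))
                     \<bullet> source0 k X a dx FS phix Ue i j))
     / sigma_denom k w U i"

definition source_corr ::
  "nat \<Rightarrow> (nat \<Rightarrow> real) \<Rightarrow> (nat \<Rightarrow> real) \<Rightarrow> real \<Rightarrow> real \<Rightarrow> (state \<Rightarrow> state \<Rightarrow> state) \<Rightarrow> (real \<Rightarrow> real)
   \<Rightarrow> (real \<Rightarrow> state) \<Rightarrow> (nat \<Rightarrow> nat \<Rightarrow> state) \<Rightarrow> nat \<Rightarrow> nat \<Rightarrow> state" where
  "source_corr k X w a dx FS phix Ue U i j =
     (if sigma_denom k w U i = 0 then 0
      else sigma k X w a dx FS phix Ue U i *\<^sub>R (entropy_var (U i j) - V_bar k w U i))"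

text \<open>Nodal values of the spatial operator, that is, the scheme solved for the time derivative.\<close>

definition dg_operator ::
  "nat \<Rightarrow> (nat \<Rightarrow> real) \<Rightarrow> (nat \<Rightarrow> real) \<Rightarrow> real \<Rightarrow> real \<Rightarrow> (state \<Rightarrow> state \<Rightarrow> state) \<Rightarrow> (real \<Rightarrow> real)
   \<Rightarrow> (real \<Rightarrow> state) \<Rightarrow> (nat \<Rightarrow> nat \<Rightarrow> state) \<Rightarrow> nat \<Rightarrow> nat \<Rightarrow> state" where
  "dg_operator k X w a dx FS phix Ue U i j =
     grav_source (U i j) (phix (node a dx X i j))
     + source0 k X a dx FS phix Ue i j
     - source_corr k X w a dx FS phix Ue U i j
     - (2 / dx) *\<^sub>R (\<Sum>l\<le>k. (2 * diff_mat k X j l) *\<^sub>R FS (U i j) (U i l))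
     - (2 / dx * (tau k j / w j)) *\<^sub>R (surface_flux k U i j - euler_flux (U i j))"

section \<open>Forward Euler step and time step restriction\<close>

definition euler_step ::
  "nat \<Rightarrow> (nat \<Rightarrow> real) \<Rightarrow> (nat \<Rightarrow> real) \<Rightarrow> real \<Rightarrow> real \<Rightarrow> (state \<Rightarrow> state \<Rightarrow> state) \<Rightarrow> (real \<Rightarrow> real)
   \<Rightarrow> (real \<Rightarrow> state) \<Rightarrow> real \<Rightarrow> (nat \<Rightarrow> nat \<Rightarrow> state) \<Rightarrow> nat \<Rightarrow> nat \<Rightarrow> state" where
  "euler_step k X w a dx FS phix Ue dt U i j =
     U i j + dt *\<^sub>R dg_operator k X w a dx FS phix Ue U i j"

definition cell_average :: "nat \<Rightarrow> (nat \<Rightarrow> real) \<Rightarrow> (nat \<Rightarrow> nat \<Rightarrow> state) \<Rightarrow> nat \<Rightarrow> state" where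
  "cell_average k w U i = (\<Sum>j\<le>k. (w j / 2) *\<^sub>R U i j)"

definition node_states :: "nat \<Rightarrow> nat \<Rightarrow> (nat \<Rightarrow> nat \<Rightarrow> state) \<Rightarrow> state set" where
  "node_states N k U = {U i j | i j. i \<in> {1..N} \<and> j \<le> k} \<union> {U 0 k, U (N + 1) 0}"

definition alpha0 :: "nat \<Rightarrow> nat \<Rightarrow> (nat \<Rightarrow> nat \<Rightarrow> state) \<Rightarrow> real" where
  "alpha0 N k U = Max ((\<lambda>W. \<bar>vel W\<bar> + sound W) ` node_states N k U)"

text \<open>
  The local viscosity \<^const>\<open>lf_alpha\<close> can exceed \<^const>\<open>alpha0\<close>, because \<^const>\<open>alpha_RRF\<close> is not
  controlled by the nodal values of \<open>|u| + c\<close> (strong collisions next to low density). The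
  classical CFL condition below bounds the viscosity at every interface, including the two
  boundary interfaces; it follows from \<open>dt < w 0 / (4 * alpha0 N k U) * dx\<close> as soon as
  \<^const>\<open>alpha_RRF\<close> is at most \<^const>\<open>alpha0\<close> at every interface. It cannot be dropped: without it the
  updated density can become negative.
\<close>

definition interface_cfl ::
  "nat \<Rightarrow> nat \<Rightarrow> (nat \<Rightarrow> real) \<Rightarrow> real \<Rightarrow> real \<Rightarrow> (nat \<Rightarrow> nat \<Rightarrow> state) \<Rightarrow> bool" where
  "interface_cfl N k w dx dt U \<longleftrightarrow>
     (\<forall>i\<le>N. dt \<le> w 0 / (4 * lf_alpha (U i k) (U (i + 1) 0)) * dx)"

text \<open>
  The quantities below depend on a nodal state \<open>W\<close>, on the vector \<open>Th\<close> (the value of \<^const>\<open>source0\<close>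
  at the node) and on the value \<open>g\<close> of the derivative of the potential.
\<close>

definition K_tilde :: "state \<Rightarrow> real" where
  "K_tilde W = (gam - 1) * (mom W)\<^sup>2 / ((gam - 1) * (mom W)\<^sup>2 + dens W * pres W)"

definition K_coef :: "state \<Rightarrow> real" where
  "K_coef W = (1 + K_tilde W) / 2"

definition A_coef :: "state \<Rightarrow> state \<Rightarrow> real \<Rightarrow> real" where
  "A_coef W Th g = 1 / (2 * K_coef W * dens W) * (Th $ 2 - dens W * g)\<^sup>2"

definition B_coef :: "state \<Rightarrow> state \<Rightarrow> real \<Rightarrow> real" where
  "B_coef W Th g = Th $ 3 - mom W * g - 1 / K_coef W * (vel W * Th $ 2 - mom W * g)"

definition C_coef :: "state \<Rightarrow> real" where
  "C_coef W = pres W / (gam - 1) - (1 - K_coef W) / (2 * K_coef W * dens W) * (mom W)\<^sup>2"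

definition t_source :: "state \<Rightarrow> state \<Rightarrow> real \<Rightarrow> real" where
  "t_source W Th g =
     (let A = A_coef W Th g; B = B_coef W Th g; C = C_coef W in
      if Th $ 1 \<noteq> 0
      then 1 / 2 * min ((B + sqrt (B\<^sup>2 + 4 * A * C)) / (2 * A))
                       ((1 - K_coef W) * dens W / \<bar>Th $ 1\<bar>)
      else (B + sqrt (B\<^sup>2 + 4 * A * C)) / (4 * A))"

end

theory Submission
  imports Defs
begin

text \<open>
  The admissible set is the open convex cone \<open>\<rho> > 0\<close>, \<open>2\<rho>E > m\<^sup>2\<close>. Summation by parts, which
  comes from the exactness of Gauss--Lobatto quadrature in degree \<open>2k - 1\<close>, turns the volume terms
  of the cell average into differences of end point fluxes, and the entropy correction has average
  zero. What remains is the mean of a source step and a flux step, both of length \<open>2 dt\<close>. The source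
  step is admissible at every node as long as a quadratic in \<open>dt\<close> stays positive. In the
  flux step each Lax--Friedrichs flux is split into the admissible states \<open>\<alpha>U \<plusminus> F(U)\<close>, and the
  end point weights pay for the negative multiples of \<open>U\<close>.
\<close>

section \<open>Gauss--Lobatto quadrature\<close>

definition pint :: "real poly \<Rightarrow> real" where
  "pint p = integral {-1..1} (poly p)"

lemma poly_integrable_on: "poly p integrable_on {a..b::real}"
  by (intro integrable_continuous_interval continuous_on_poly continuous_on_id)

lemma pint_add: "pint (p + q) = pint p + pint q"
proof -
  have "poly (p + q) = (\<lambda>x. poly p x + poly q x)"
    by (simp add: fun_eq_iff)
  then show ?thesis
    by (simp add: pint_def integral_add poly_integrable_on)
qed

lemma pint_smult: "pint (smult c p) = c * pint p"
proof -
  have "poly (smult c p) = (\<lambda>x. c * poly p x)"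
    by (simp add: fun_eq_iff)
  then show ?thesis
    by (simp add: pint_def)
qed

lemma pint_0 [simp]: "pint 0 = 0"
  using pint_smult[of 0 0] by simp

lemma pint_sum: "pint (sum f A) = (\<Sum>x\<in>A. pint (f x))"
  by (induction A rule: infinite_finite_induct) (simp_all add: pint_add)

lemma pint_pderiv: "pint (pderiv p) = poly p 1 - poly p (-1)"
  unfolding pint_def
  by (intro integral_unique fundamental_theorem_of_calculus)
     (auto simp flip: has_real_derivative_iff_has_vector_derivative
           intro: has_field_derivative_at_within)

lemma pint_by_parts:
  "pint (pderiv p * q) = poly (p * q) 1 - poly (p * q) (-1) - pint (p * pderiv q)"
  using pint_pderiv[of "p * q"] by (simp add: pderiv_mult pint_add mult.commute)

text \<open>A continuous nonnegative function with zero integral vanishes on the whole interval,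
  whereas a nonzero polynomial has only finitely many roots.\<close>

lemma pint_pos:
  assumes "\<And>x. x \<in> {-1..1} \<Longrightarrow> 0 \<le> poly p x" and "p \<noteq> 0"
  shows "0 < pint p"
proof -
  have "pint p \<noteq> 0"
  proof
    assume "pint p = 0"
    moreover have "continuous_on {-1..1} (poly p)"
      by (intro continuous_on_poly continuous_on_id)
    ultimately have "poly p x = 0" if "x \<in> {-1..1}" for x
      using that integral_eq_0_iff[of "-1" 1 "poly p"] assms(1) by (simp add: pint_def)
    then have "{-1..1} \<subseteq> {x. poly p x = 0}"
      by auto
    then show False
      using poly_roots_finite[OF assms(2)] infinite_Icc[of "-1::real" 1]
      by (meson finite_subset zero_less_one neg_less_0_iff_less less_trans)
  qed
  moreover have "0 \<le> pint p"
    unfolding pint_def by (intro integral_nonneg poly_integrable_on) (use assms(1) in auto)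
  ultimately show ?thesis by linarith
qed

section \<open>Orthogonality and parity of Legendre polynomials\<close>

text \<open>By the product rule, each differentiation costs at most one factor
  \<open>p\<close>.\<close>

lemma power_dvd_higher_pderiv:
  assumes "m \<le> n"
  shows "p ^ (n - m) dvd (pderiv ^^ m) (p ^ n :: real poly)"
  using assms
proof (induction m)
  case (Suc m)
  then obtain s where s: "(pderiv ^^ m) (p ^ n) = p ^ (n - m) * s"
    by (auto elim: dvdE)
  define e where "e = n - Suc m"
  have "n - m = Suc e"
    using Suc.prems by (simp add: e_def)
  then have "(pderiv ^^ Suc m) (p ^ n) = pderiv (p ^ Suc e * s)"
    by (simp add: s)
  also have "\<dots> = p ^ e * (p * pderiv s + s * smult (of_nat (Suc e)) (pderiv p))"
    unfolding pderiv_mult pderiv_power_Suc by (simp add: algebra_simps del: of_nat_Suc)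
  finally have "(pderiv ^^ Suc m) (p ^ n) = \<dots>" .
  then show ?case
    by (simp add: e_def)
qed simp

text \<open>Integration by parts moves the derivatives onto \<open>q\<close> one at a time. Boundary
  terms vanish because fewer than \<open>n\<close> derivatives leave a factor x^2 - 1. Keeping
  \<open>m\<close> separate from \<open>n\<close> lets the induction run; Rodrigues' formula is the
  case \<open>m = n\<close>.\<close>

lemma pint_higher_pderiv_ortho:
  assumes "m \<le> n" and "degree q < m"
  shows "pint ((pderiv ^^ m) ([:-1, 0, 1:] ^ n) * q) = 0"
  using assms
proof (induction m arbitrary: q)
  case (Suc m)
  let ?R = "(pderiv ^^ m) ([:-1, 0, 1:] ^ n) :: real poly"
  have "[:-1, 0, 1:] dvd ?R"
    using power_dvd_higher_pderiv[of m n "[:-1, 0, 1:]"] Suc.prems(1)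
    by (metis Suc_le_lessD dvd_trans dvd_power less_imp_le zero_less_diff)
  then have "poly ?R 1 = 0" "poly ?R (-1) = 0"
    by (auto elim!: dvdE)
  then have "pint (pderiv ?R * q) = - pint (?R * pderiv q)"
    by (simp add: pint_by_parts)
  also have "pint (?R * pderiv q) = 0"
  \<comment> \<open>Differentiation lowers the degree only of a nonconstant \<open>q\<close>; for a
    constant, \<open>pderiv q\<close> is zero.\<close>
  proof (cases "degree q = 0")
    case False
    then show ?thesis
      using Suc by (intro Suc.IH) (auto simp: degree_pderiv)
  qed (simp flip: pderiv_eq_0_iff)
  finally show ?case by simp
qed simp

lemma pint_legendre_ortho:
  assumes "degree q < n"
  shows "pint (legendre n * q) = 0"
  using pint_higher_pderiv_ortho[OF order_refl assms]
  by (simp add: legendre_def pint_smult)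

lemma degree_legendre: "degree (legendre n) = n"
  by (simp add: legendre_def degree_higher_pderiv degree_power_eq)

lemma higher_pderiv_reflect:
  "(pderiv ^^ n) (pcompose p [:0, -1:])
     = smult ((-1) ^ n) (pcompose ((pderiv ^^ n) p) [:0, -1:] :: real poly)"
  by (induction n) (simp_all add: pderiv_smult pderiv_pcompose pderiv_pCons)

text \<open>The power of x^2 - 1 in Rodrigues' formula is even, and each of the \<open>n\<close>
  derivatives contributes a sign.\<close>

lemma legendre_reflect:
  "pcompose (legendre n) [:0, -1:] = smult ((-1) ^ n) (legendre n)"
proof -
  have "pcompose ([:-1, 0, 1:] ^ n) [:0, -1:] = ([:-1, 0, 1:] ^ n :: real poly)"
    by (simp add: fun_eq_iff poly_pcompose flip: poly_eq_poly_eq_iff)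
  then have "smult ((-1) ^ n) ((pderiv ^^ n) ([:-1, 0, 1:] ^ n))
      = pcompose ((pderiv ^^ n) ([:-1, 0, 1:] ^ n)) [:0, -1 :: real:]"
    using arg_cong[OF higher_pderiv_reflect[of n "[:-1, 0, 1:] ^ n"], of "smult ((-1) ^ n)"]
    by (simp flip: power_mult_distrib)
  from this [symmetric] show ?thesis
    by (simp add: legendre_def pcompose_smult)
qed

text \<open>Squaring removes the parity sign; \<open>weight_sym\<close> needs an even
  function.\<close>

lemma poly_pderiv_legendre_minus:
  "(poly (pderiv (legendre n)) (- x))\<^sup>2 = (poly (pderiv (legendre n)) x)\<^sup>2"
proof -
  have "smult (-1) (pcompose (pderiv (legendre n)) [:0, -1:]) = smult ((-1) ^ n) (pderiv (legendre n))"
    using arg_cong[OF legendre_reflect[of n], of pderiv]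
    by (simp add: pderiv_pcompose pderiv_smult pderiv_pCons)
  from arg_cong[OF this, of "\<lambda>p. (poly p x)\<^sup>2"] show ?thesis
    by (simp add: poly_pcompose power_mult_distrib flip: power_mult)
qed

lemma pint_odd:
  assumes "\<And>x. poly p (- x) = - poly p x"
  shows "pint p = 0"
proof -
  have "integral {-1..1} (\<lambda>x. poly p (- x)) = pint p"
    unfolding pint_def
    using Henstock_Kurzweil_Integration.integral_reflect_real[of 1 "-1" "poly p"] by simp
  then show ?thesis
    by (simp add: assms pint_def)
qed

section \<open>Lagrange interpolation and quadrature at the Lobatto nodes\<close>

lemma poly_lagrange_basis:
  "poly (lagrange_basis k X l) x = (\<Prod>j\<in>{..k} - {l}. (x - X j) / (X l - X j))"
  by (simp add: lagrange_basis_def poly_prod diff_divide_distrib)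

lemma degree_lagrange_basis: "l \<le> k \<Longrightarrow> degree (lagrange_basis k X l) \<le> k"
proof -
  assume "l \<le> k"
  have "degree (lagrange_basis k X l) \<le> sum (degree \<circ> (\<lambda>j. smult (1 / (X l - X j)) [:- X j, 1:])) ({..k} - {l})"
    unfolding lagrange_basis_def by (intro degree_prod_sum_le) auto
  also have "\<dots> \<le> (\<Sum>j\<in>{..k} - {l}. 1)"
    by (intro sum_mono) (auto simp: degree_smult_le)
  also have "\<dots> = k"
    using \<open>l \<le> k\<close> by simp
  finally show ?thesis .
qed

context
  fixes k :: nat and X w :: "nat \<Rightarrow> real"
  assumes k: "1 \<le> k" and gl: "gauss_lobatto k X w"
begin

lemma
  shows X_0: "X 0 = -1" and X_k: "X k = 1"
    and inj_X: "inj_on X {..k}"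
    and w_eq: "j \<le> k \<Longrightarrow> w j = pint (lagrange_basis k X j)"
    and X_root: "0 < j \<Longrightarrow> j < k \<Longrightarrow> poly (pderiv (legendre k)) (X j) = 0"
  using gl by (auto simp: gauss_lobatto_def pint_def intro: strict_mono_on_imp_inj_on)

lemma X_bounds:
  assumes "j \<le> k"
  shows "-1 \<le> X j" "X j \<le> 1"
proof -
  have "mono_on {..k} X"
    using gl by (simp add: gauss_lobatto_def strict_mono_on_imp_mono_on)
  then show "-1 \<le> X j" "X j \<le> 1"
    using assms mono_onD[of "{..k}" X 0 j] mono_onD[of "{..k}" X j k] by (auto simp: X_0 X_k)
qed

lemma poly_lagrange_basis_node:
  assumes "j \<le> k" "l \<le> k"
  shows "poly (lagrange_basis k X l) (X j) = (if j = l then 1 else 0)"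
proof (cases "j = l")
  case True
  have "(\<Prod>i\<in>{..k} - {l}. (X l - X i) / (X l - X i)) = (\<Prod>i\<in>{..k} - {l}. 1)"
    using inj_X assms by (intro prod.cong) (auto simp: inj_on_def)
  then show ?thesis
    using True by (simp add: poly_lagrange_basis)
next
  case False
  then show ?thesis
    using assms by (auto simp: poly_lagrange_basis)
qed

text \<open>Both sides have degree at most \<open>k\<close> and agree at \<open>k + 1\<close>
  distinct nodes.\<close>

lemma lagrange_interpolation:
  assumes "degree p \<le> k"
  shows "p = (\<Sum>l\<le>k. smult (poly p (X l)) (lagrange_basis k X l))" (is "_ = ?q")
proof (rule poly_eqI_degree)
  show "poly p x = poly ?q x" if "x \<in> X ` {..k}" for x
    using that by (auto simp: poly_sum poly_lagrange_basis_node if_distrib cong: if_cong)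
  have "degree ?q \<le> k"
    by (intro degree_sum_le) (auto intro: order_trans[OF degree_smult_le] degree_lagrange_basis)
  then show "degree p < card (X ` {..k})" "degree ?q < card (X ` {..k})"
    using assms by (simp_all add: card_image inj_X)
qed

text \<open>Division by the nodal polynomial \<open>W\<close>, which is x^2 - 1 times the derivative
  of the Legendre polynomial. The remainder has degree at most \<open>k\<close> and equals its
  interpolant, so the weights integrate it exactly. The multiple of \<open>W\<close> vanishes at all
  nodes, and its integral is zero: after integration by parts the Legendre polynomial meets a factor
  of degree below \<open>k\<close>.\<close>

lemma lobatto_exact:
  assumes "degree p < 2 * k"
  shows "pint p = (\<Sum>j\<le>k. w j * poly p (X j))"
proof -
  define W where "W = [:-1, 0, 1:] * pderiv (legendre k)"
  have P0: "pderiv (legendre k) \<noteq> 0"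
    using k by (simp add: pderiv_eq_0_iff degree_legendre)
  then have dW: "degree W = k + 1" and "W \<noteq> 0"
    using k by (auto simp: W_def degree_mult_eq degree_pderiv degree_legendre simp del: mult_pCons_left)
  have W_root: "poly W (X j) = 0" if "j \<le> k" for j
    using that X_root[of j] X_0 X_k unfolding W_def
    by (cases "j = 0"; cases "j = k") auto
  define q r where "q = p div W" and "r = p mod W"
  have p: "p = W * q + r"
    by (simp add: q_def r_def)
  have dr: "degree r \<le> k"
    using degree_mod_less[OF \<open>W \<noteq> 0\<close>, of p] dW by (auto simp: r_def)
  have "pint (W * q) = 0"
  proof (cases "q = 0")
    case False
    have "degree (W * q) < 2 * k"
    proof -
      have "W * q = p - r"
        using p by simp
      then show ?thesis
        using assms dr k by (auto intro: le_less_trans[OF degree_diff_le_max])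
    qed
    then have "degree q + 1 < k"
      using \<open>W \<noteq> 0\<close> False by (simp add: degree_mult_eq dW)
    then have "degree (pderiv ([:-1, 0, 1:] * q)) < k"
      using False by (simp add: degree_pderiv degree_mult_eq del: mult_pCons_left)
    then have "pint (legendre k * pderiv ([:-1, 0, 1:] * q)) = 0"
      by (rule pint_legendre_ortho)
    then show ?thesis
      using pint_by_parts[of "legendre k" "[:-1, 0, 1:] * q"]
      by (simp add: W_def ac_simps del: mult_pCons_left mult_pCons_right)
  qed simp
  then have "pint p = pint r"
    using p by (simp add: pint_add)
  also have "\<dots> = (\<Sum>j\<le>k. w j * poly r (X j))"
    by (subst lagrange_interpolation[OF dr]) (auto simp: pint_sum pint_smult w_eq mult.commute)
  also have "\<dots> = (\<Sum>j\<le>k. w j * poly p (X j))"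
    by (intro sum.cong) (auto simp: p W_root)
  finally show ?thesis .
qed

lemma sum_weights: "(\<Sum>j\<le>k. w j) = 2"
proof -
  have "pint 1 = 2"
    using pint_pderiv[of "[:0, 1:]"] by (simp add: pderiv_pCons one_pCons)
  then show ?thesis
    using lobatto_exact[of 1] k by simp
qed

text \<open>Exactness is applied to a nonzero polynomial \<open>q\<close> that is nonnegative on the
  interval and vanishes at every node except \<open>X j\<close>, so that its integral is
  \<open>w j * poly q (X j)\<close>.\<close>

lemma weight_pos:
  assumes j: "j \<le> k"
  shows "0 < w j"
proof -
  define I where "I = {0<..<k} - {j}"
  \<comment> \<open>At the end points first powers suffice, since \<open>1 + x\<close> and
    \<open>1 - x\<close> do not change sign on the interval. Squares there would raise the degree to
    \<open>2 * k\<close>, beyond exactness.\<close>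
  define e where "e = (if j = 0 then 1 else [:1, 1:]) * (if j = k then 1 else [:1, -1:] :: real poly)"
  define q where "q = e * (\<Prod>l\<in>I. [:- X l, 1:] ^ 2)"
  have q: "poly q x = poly e x * (\<Prod>l\<in>I. (x - X l)\<^sup>2)" for x
    by (simp add: q_def poly_prod)
  have dq: "degree q < 2 * k"
  proof -
    have "degree (\<Prod>l\<in>I. [:- X l, 1:] ^ 2) \<le> sum (degree \<circ> (\<lambda>l. [:- X l, 1:] ^ 2)) I"
      unfolding I_def by (intro degree_prod_sum_le) auto
    also have "\<dots> = 2 * card I"
      by (simp add: degree_power_eq)
    finally have d: "degree q \<le> degree e + 2 * card I"
      unfolding q_def by (meson add_left_mono degree_mult_le order_trans)
    show ?thesis
    proof (cases "j = 0 \<or> j = k")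
      case True
      then have "degree e \<le> 1" "card I \<le> k - 1"
        using k by (auto simp: e_def I_def simp del: mult_pCons_left mult_pCons_right)
      then show ?thesis
        using d k by linarith
    next
      case False
      then have "degree e \<le> 2" "card I \<le> k - 2" "2 \<le> k"
        using j by (auto simp: e_def I_def)
      then show ?thesis
        using d by linarith
    qed
  qed
  have nz: "poly q (X l) = 0" if l: "l \<le> k" "l \<noteq> j" for l
  proof -
    consider "l = 0" | "l = k" | "l \<in> I"
      using l by (force simp: I_def)
    then show ?thesis
      using l by cases (auto simp: q e_def X_0 X_k I_def)
  qed
  have e_nonneg: "0 \<le> poly e x" if "x \<in> {-1..1}" for x
    using that by (auto simp: e_def)
  have nonneg: "0 \<le> poly q x" if "x \<in> {-1..1}" for x
    using e_nonneg[OF that] by (simp add: q prod_nonneg)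
  have "X j \<noteq> X l" if "l \<le> k" "l \<noteq> j" for l
    using inj_X j that by (auto simp: inj_on_def)
  from this[of 0] this[of k] this have "poly e (X j) \<noteq> 0" "\<forall>l\<in>I. X j \<noteq> X l"
    using X_0 X_k by (auto simp: e_def I_def add_eq_0_iff)
  then have "poly q (X j) \<noteq> 0"
    by (simp add: q I_def)
  moreover have "0 \<le> poly q (X j)"
    using X_bounds[OF j] by (intro nonneg) auto
  ultimately have qj: "0 < poly q (X j)"
    by linarith
  then have "q \<noteq> 0"
    by auto
  with nonneg have "0 < pint q"
    by (rule pint_pos)
  also have "pint q = (\<Sum>l\<le>k. if l = j then w j * poly q (X j) else 0)"
    unfolding lobatto_exact[OF dq] by (intro sum.cong) (auto simp: nz)
  also have "\<dots> = w j * poly q (X j)"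
    using j by simp
  finally show ?thesis
    using qj by (simp add: zero_less_mult_iff)
qed

text \<open>The odd polynomial \<open>f\<close> of degree \<open>2 * k - 1\<close> has integral zero
  and vanishes at the interior nodes, so exactness balances the two end point terms.\<close>

lemma weight_sym: "w k = w 0"
proof -
  let ?P = "pderiv (legendre k)"
  define f where "f = [:0, 1:] * ?P ^ 2"
  have f: "poly f x = x * (poly ?P x)\<^sup>2" for x
    by (simp add: f_def)
  have P0: "?P \<noteq> 0"
    using k by (simp add: pderiv_eq_0_iff degree_legendre)
  have df: "degree f < 2 * k"
    using P0 k by (simp add: f_def degree_mult_eq degree_power_eq degree_pderiv degree_legendre
        del: mult_pCons_left)
  \<comment> \<open>Otherwise \<open>?P\<close>, of degree \<open>k - 1\<close>, would have the
    \<open>k\<close> distinct roots \<open>X 1\<close>, ..., \<open>X k\<close>.\<close>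
  have "poly ?P 1 \<noteq> 0"
  proof
    assume "poly ?P 1 = 0"
    then have "poly ?P x = 0" if "x \<in> X ` {0<..k}" for x
      using that X_root X_k by (force simp: le_less)
    moreover have "inj_on X {0<..k}"
      using inj_X by (rule inj_on_subset) auto
    ultimately have "?P = 0"
      using k by (intro poly_eqI_degree[of "X ` {0<..k}"])
                 (auto simp: card_image degree_pderiv degree_legendre)
    with P0 show False ..
  qed
  have "0 = pint f"
    by (rule pint_odd[symmetric]) (simp add: f poly_pderiv_legendre_minus)
  also have "\<dots> = (\<Sum>j\<in>{0, k}. w j * poly f (X j))"
    unfolding lobatto_exact[OF df] using X_root by (intro sum.mono_neutral_right) (auto simp: f)
  also have "\<dots> = (w k - w 0) * (poly ?P 1)\<^sup>2"
    using k poly_pderiv_legendre_minus[of k 1] by (simp add: f X_0 X_k algebra_simps)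
  finally show ?thesis
    using \<open>poly ?P 1 \<noteq> 0\<close> by simp
qed

text \<open>The left side is the quadrature of the derivative of a product of two basis polynomials.
  Its degree is below \<open>2 * k\<close>, so the quadrature is exact and only the end point values
  remain.\<close>

lemma summation_by_parts:
  assumes "j \<le> k" "l \<le> k"
  shows "w j * diff_mat k X j l + w l * diff_mat k X l j = (if j = l then tau k j else 0)"
proof -
  let ?L = "lagrange_basis k X"
  have d: "degree (?L i * pderiv (?L m)) < 2 * k" if "i \<le> k" "m \<le> k" for i m
  proof -
    have "degree (?L i * pderiv (?L m)) \<le> k + (k - 1)"
      using degree_lagrange_basis[OF that(1), of X] degree_lagrange_basis[OF that(2), of X]
      by (intro order_trans[OF degree_mult_le] add_mono) (auto simp: degree_pderiv)
    then show ?thesis using k by linarith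
  qed
  have q: "pint (?L i * pderiv (?L m)) = w i * diff_mat k X i m" if "i \<le> k" "m \<le> k" for i m
  proof -
    have "pint (?L i * pderiv (?L m)) = (\<Sum>n\<le>k. if n = i then w i * diff_mat k X i m else 0)"
      unfolding lobatto_exact[OF d[OF that]]
      by (intro sum.cong) (use that in \<open>auto simp: poly_lagrange_basis_node diff_mat_def\<close>)
    then show ?thesis using that by simp
  qed
  have "w j * diff_mat k X j l + w l * diff_mat k X l j = pint (pderiv (?L j * ?L l))"
    using assms by (simp add: pderiv_mult pint_add q)
  also have "\<dots> = poly (?L j * ?L l) (X k) - poly (?L j * ?L l) (X 0)"
    by (simp add: pint_pderiv X_0 X_k)
  also have "\<dots> = (if j = l then tau k j else 0)"
    using assms k by (auto simp: poly_lagrange_basis_node tau_def)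
  finally show ?thesis .
qed

end

section \<open>The admissible set\<close>

text \<open>For positive density, multiplying the pressure by \<open>2 * U $ 1\<close> removes the
  quotient; \<open>2 / 5\<close> is \<open>gam - 1\<close>.\<close>

lemma admissible_iff: "U \<in> admissible \<longleftrightarrow> 0 < U $ 1 \<and> (U $ 2)\<^sup>2 < 2 * U $ 1 * U $ 3"
proof (cases "0 < U $ 1")
  case True
  have "2 * U $ 1 * pres U = (2 / 5) * (2 * U $ 1 * U $ 3 - (U $ 2)\<^sup>2)"
    using True by (simp add: pres_def gam_def dens_def mom_def energy_def vel_def field_simps power2_eq_square)
  moreover have "0 < pres U \<longleftrightarrow> 0 < 2 * U $ 1 * pres U"
    using True by (simp add: zero_less_mult_iff)
  ultimately have "0 < pres U \<longleftrightarrow> 0 < (2 / 5) * (2 * U $ 1 * U $ 3 - (U $ 2)\<^sup>2)"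
    by (simp only:)
  also have "\<dots> \<longleftrightarrow> (U $ 2)\<^sup>2 < 2 * U $ 1 * U $ 3"
    by (simp add: zero_less_mult_iff mult.assoc)
  finally have "0 < pres U \<longleftrightarrow> (U $ 2)\<^sup>2 < 2 * U $ 1 * U $ 3" .
  then show ?thesis
    using True by (simp add: admissible_def dens_def)
qed (simp add: admissible_def dens_def)

lemma admissible_scaleR: "0 < c \<Longrightarrow> U \<in> admissible \<Longrightarrow> c *\<^sub>R U \<in> admissible"
proof -
  assume c: "0 < c" and U: "U \<in> admissible"
  have "c\<^sup>2 * (U $ 2)\<^sup>2 < c\<^sup>2 * (2 * U $ 1 * U $ 3)"
    using c U by (intro mult_strict_left_mono) (auto simp: admissible_iff)
  then show ?thesis
    using c U by (simp add: admissible_iff power_mult_distrib power2_eq_square mult_ac)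
qed

text \<open>Only the mixed term of the squared momentum needs an argument: the inequality of
  arithmetic and geometric means for \<open>m1 * r2\<close> and \<open>m2 * r1\<close>, then
  cancellation of \<open>r1 * r2\<close>.\<close>

lemma admissible_add:
  assumes "U \<in> admissible" "V \<in> admissible"
  shows "U + V \<in> admissible"
proof -
  define r1 m1 e1 r2 m2 e2 where "r1 = U $ 1" "m1 = U $ 2" "e1 = U $ 3"
    and "r2 = V $ 1" "m2 = V $ 2" "e2 = V $ 3"
  note d = this
  have *: "0 < r1" "0 < r2" "m1\<^sup>2 < 2 * r1 * e1" "m2\<^sup>2 < 2 * r2 * e2"
    using assms by (simp_all add: d admissible_iff)
  have "2 * (m1 * r2) * (m2 * r1) \<le> (m1 * r2)\<^sup>2 + (m2 * r1)\<^sup>2"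
    by (rule sum_squares_bound)
  also have "\<dots> = r2\<^sup>2 * m1\<^sup>2 + r1\<^sup>2 * m2\<^sup>2"
    by (simp add: power_mult_distrib)
  also have "\<dots> < r2\<^sup>2 * (2 * r1 * e1) + r1\<^sup>2 * (2 * r2 * e2)"
    using * by (intro add_strict_mono mult_strict_left_mono) auto
  finally have "(r1 * r2) * (2 * m1 * m2) < (r1 * r2) * (2 * r2 * e1 + 2 * r1 * e2)"
    by (simp add: power2_eq_square algebra_simps)
  then have "2 * m1 * m2 < 2 * r2 * e1 + 2 * r1 * e2"
    using * by (simp only: mult_less_cancel_left_pos mult_pos_pos)
  then have "(m1 + m2)\<^sup>2 < 2 * (r1 + r2) * (e1 + e2)"
    using * by (simp add: power2_sum algebra_simps)
  then show ?thesis
    using * by (simp add: admissible_iff d)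
qed

text \<open>A zero factor is allowed because the leftover multiple of \<open>U\<close> in the flux
  splitting vanishes when the CFL bound is attained.\<close>

lemma admissible_scaleR_add:
  assumes "0 \<le> c" "U \<in> admissible" "V \<in> admissible"
  shows "c *\<^sub>R U + V \<in> admissible"
  using assms by (cases "c = 0") (simp_all add: admissible_scaleR admissible_add)

text \<open>The extra summand \<open>V\<close> covers the empty sum: zero is not admissible, and
  there are no interior nodes when \<open>k = 1\<close>.\<close>

lemma admissible_sum_add:
  assumes "finite I" "\<And>j. j \<in> I \<Longrightarrow> f j \<in> admissible" "V \<in> admissible"
  shows "sum f I + V \<in> admissible"
  using assms
  by (induction I rule: finite_induct) (simp_all add: admissible_add add.assoc)

lemma sound_pos: "U \<in> admissible \<Longrightarrow> 0 < sound U"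
  by (simp add: admissible_def sound_def gam_def)

text \<open>
  For \<open>W = \<alpha>U + sF(U)\<close> and \<open>b = \<alpha> + su\<close> one finds \<open>2 W\<^sub>1 W\<^sub>3 - W\<^sub>2\<^sup>2 = 2\<rho>pb\<^sup>2 / (\<gamma> - 1) - p\<^sup>2\<close>,
  and \<open>b \<ge> c\<close>.
\<close>

lemma admissible_flux:
  assumes U: "U \<in> admissible" and a: "\<bar>vel U\<bar> + sound U \<le> a" and s: "s = 1 \<or> s = -1"
  shows "a *\<^sub>R U + s *\<^sub>R euler_flux U \<in> admissible"
proof -
  define r m E u p where "r = U $ 1" "m = U $ 2" "E = U $ 3" "u = vel U" "p = pres U"
  note d = this
  define b where "b = a + s * u"
  have rp: "0 < r" "0 < p"
    using U by (simp_all add: d admissible_def dens_def)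
  have m: "m = r * u"
    using rp by (simp add: d vel_def dens_def mom_def)
  have E: "2 * E = 5 * p + r * u\<^sup>2"
    by (simp add: d pres_def gam_def dens_def energy_def field_simps)
  have "sound U \<le> b"
    using a s by (auto simp: b_def d)
  then have b: "0 < b" "(sound U)\<^sup>2 \<le> b\<^sup>2"
    using sound_pos[OF U] by (auto intro: power_mono)
  have "(sound U)\<^sup>2 = 7 / 5 * p / r"
    using rp by (simp add: sound_def gam_def d dens_def)
  then have "7 / 5 * p / r \<le> b\<^sup>2"
    using b by simp
  then have "7 / 5 * p \<le> r * b\<^sup>2"
    using rp by (simp add: pos_divide_le_eq mult_ac)
  then have "p * (7 / 5 * p) \<le> p * (r * b\<^sup>2)"
    using rp by (intro mult_left_mono) auto
  moreover have "0 < p * p"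
    using rp by simp
  \<comment> \<open>The bound by the sound speed gives 7 p^2 \<le> 5 p r b^2; strictness comes from
    7 = 2 gam / (gam - 1) exceeding 1.\<close>
  ultimately have *: "p\<^sup>2 < 5 * p * r * b\<^sup>2"
    by (simp add: power2_eq_square algebra_simps)
  have "2 * (r * b) * (E * b + s * u * p) - (m * b + s * p)\<^sup>2 = 5 * p * r * b\<^sup>2 - (s * p)\<^sup>2"
  proof -
    have "2 * (r * b) * (E * b + s * u * p) = r * b * (2 * E * b + 2 * s * u * p)"
      by (simp add: algebra_simps)
    then show ?thesis
      unfolding E m by (simp add: algebra_simps power2_eq_square)
  qed
  moreover have "(s * p)\<^sup>2 = p\<^sup>2"
    using s by auto
  ultimately have "(m * b + s * p)\<^sup>2 < 2 * (r * b) * (E * b + s * u * p)"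
    using * by linarith
  moreover have "(a *\<^sub>R U + s *\<^sub>R euler_flux U) $ 1 = r * b"
    and "(a *\<^sub>R U + s *\<^sub>R euler_flux U) $ 2 = m * b + s * p"
    and "(a *\<^sub>R U + s *\<^sub>R euler_flux U) $ 3 = E * b + s * u * p"
    using m by (simp_all add: euler_flux_def b_def d dens_def mom_def energy_def power2_eq_square algebra_simps)
  ultimately show ?thesis
    using rp b by (simp add: admissible_iff)
qed

lemma lf_alpha_ge:
  "\<bar>vel UL\<bar> + sound UL \<le> lf_alpha UL UR" "\<bar>vel UR\<bar> + sound UR \<le> lf_alpha UL UR"
  by (simp_all add: lf_alpha_def)

lemma lf_alpha_pos: "UL \<in> admissible \<Longrightarrow> 0 < lf_alpha UL UR"
  using lf_alpha_ge(1)[of UL UR] sound_pos[of UL] by linarith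

text \<open>The viscosity removes \<open>h * a / 2\<close> times \<open>U\<close>. Taking the same
  amount again from \<open>c\<close> completes the flux of \<open>U\<close> to
  \<open>a *\<^sub>R U + euler_flux U\<close>, hence the bound \<open>h * a \<le> c\<close>. The
  outflow case is the same with the opposite flux sign.\<close>

lemma lf_flux_inflow_admissible:
  assumes "UL \<in> admissible" "U \<in> admissible" "0 < h" "h * lf_alpha UL U \<le> c"
  shows "c *\<^sub>R U + h *\<^sub>R lf_flux UL U \<in> admissible"
proof -
  define a where "a = lf_alpha UL U"
  have "c *\<^sub>R U + h *\<^sub>R lf_flux UL U =
      (c - h * a) *\<^sub>R U + ((h / 2) *\<^sub>R (a *\<^sub>R U + 1 *\<^sub>R euler_flux U)
        + (h / 2) *\<^sub>R (a *\<^sub>R UL + 1 *\<^sub>R euler_flux UL))"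
    unfolding lf_flux_def a_def[symmetric] by (simp add: vec_eq_iff field_simps)
  moreover have "\<dots> \<in> admissible"
    unfolding a_def using assms lf_alpha_ge
    by (intro admissible_scaleR_add admissible_add admissible_scaleR admissible_flux) auto
  ultimately show ?thesis by simp
qed

lemma lf_flux_outflow_admissible:
  assumes "U \<in> admissible" "UR \<in> admissible" "0 < h" "h * lf_alpha U UR \<le> c"
  shows "c *\<^sub>R U - h *\<^sub>R lf_flux U UR \<in> admissible"
proof -
  define a where "a = lf_alpha U UR"
  have "c *\<^sub>R U - h *\<^sub>R lf_flux U UR =
      (c - h * a) *\<^sub>R U + ((h / 2) *\<^sub>R (a *\<^sub>R U + (-1) *\<^sub>R euler_flux U)
        + (h / 2) *\<^sub>R (a *\<^sub>R UR + (-1) *\<^sub>R euler_flux UR))"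
    unfolding lf_flux_def a_def[symmetric] by (simp add: vec_eq_iff field_simps)
  moreover have "\<dots> \<in> admissible"
    unfolding a_def using assms lf_alpha_ge
    by (intro admissible_scaleR_add admissible_add admissible_scaleR admissible_flux) auto
  ultimately show ?thesis by simp
qed

section \<open>The source step\<close>

text \<open>After multiplication by \<open>4 * A\<close> the difference of the two sides factors
  into \<open>B + s - 2 * A * t\<close>, positive before the root, and
  \<open>2 * A * t + (s - B)\<close>, positive because the root \<open>s\<close> of the discriminant
  exceeds \<open>\<bar>B\<bar>\<close>.\<close>

lemma quadratic_pos_before_root:
  fixes A B C t :: real
  assumes "0 < A" "0 < C" "0 \<le> t" "t < (B + sqrt (B\<^sup>2 + 4 * A * C)) / (2 * A)"
  shows "A * t\<^sup>2 < B * t + C"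
proof -
  define s where "s = sqrt (B\<^sup>2 + 4 * A * C)"
  have "0 < 4 * A * C"
    using assms by simp
  then have s2: "s\<^sup>2 = B\<^sup>2 + 4 * A * C" and "\<bar>B\<bar> < s"
    by (simp_all add: s_def real_less_rsqrt)
  have "2 * A * t < B + s"
    using assms(1,4) by (simp add: s_def field_simps)
  moreover have "0 \<le> A * t"
    using assms by simp
  ultimately have "0 < (B + s - 2 * A * t) * (2 * A * t + (s - B))"
    using \<open>\<bar>B\<bar> < s\<close> by (intro mult_pos_pos) linarith+
  also have "\<dots> = s\<^sup>2 - B\<^sup>2 + 4 * A * (B * t) - 4 * A * (A * t\<^sup>2)"
    by (simp add: algebra_simps power2_eq_square)
  also have "\<dots> = 4 * A * (B * t + C - A * t\<^sup>2)"
    by (simp add: s2 algebra_simps)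
  finally show ?thesis
    using assms(1) by (simp add: zero_less_mult_iff)
qed

text \<open>\<open>C_coef W\<close> is positive exactly when \<open>K\<close> exceeds (gam - 1) m^2
  / ((gam - 1) m^2 + 2 r p). This threshold is at most \<open>K_tilde W\<close>, and
  \<open>K\<close> lies midway between \<open>K_tilde W\<close> and 1.\<close>

lemma K_coef_bounds:
  assumes "W \<in> admissible"
  shows "0 < K_coef W" "K_coef W < 1" "0 < C_coef W"
proof -
  define r m p where "r = dens W" "m = mom W" "p = pres W"
  note d = this
  define K where "K = K_coef W"
  have rp: "0 < r" "0 < p"
    using assms by (simp_all add: d admissible_def)
  define D where "D = 2 / 5 * m\<^sup>2 + r * p"
  have D: "0 < D" "2 / 5 * m\<^sup>2 < D"
    using rp by (simp_all add: D_def add_nonneg_pos)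
  define q where "q = 2 / 5 * m\<^sup>2 / D"
  have K: "K = (1 + q) / 2"
    by (simp add: K_def K_coef_def K_tilde_def gam_def d D_def q_def)
  have "0 \<le> q" "q < 1"
    using D by (simp_all add: q_def)
  then have K01: "0 < K" "K < 1"
    by (simp_all add: K)
  \<comment> \<open>\<open>D\<close> is the denominator of \<open>K_tilde W\<close>, so
    \<open>1 - K\<close> equals \<open>r * p / (2 * D)\<close>.\<close>
  have "(1 - K) * (2 * D) = D - 2 / 5 * m\<^sup>2"
    using D(1) by (simp add: K q_def field_simps)
  then have "(1 - K) * (2 * D) = r * p"
    by (simp add: D_def)
  moreover have "(1 - K) * m\<^sup>2 * 4 / 5 = (1 - K) * (2 * D) - (1 - K) * (2 * (r * p))"
    by (simp add: D_def field_simps)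
  ultimately have "(1 - K) * m\<^sup>2 * 4 / 5 = r * p - (1 - K) * (2 * (r * p))"
    by simp
  also have "\<dots> = 2 * (K * (r * p)) - r * p"
    by (simp add: algebra_simps)
  also have "\<dots> < 4 * (K * (r * p))"
  proof -
    have "0 < r * p" "0 < K * (r * p)"
      using rp K01 by simp_all
    then show ?thesis by linarith
  qed
  finally have "(1 - K) * m\<^sup>2 < 5 / 2 * p * (2 * K * r)"
    by (simp add: mult_ac)
  moreover have "0 < 2 * K * r"
    using rp K01 by simp
  ultimately have "(1 - K) * m\<^sup>2 / (2 * K * r) < 5 / 2 * p"
    by (simp only: pos_divide_less_eq)
  moreover have "C_coef W = 5 / 2 * p - (1 - K) * m\<^sup>2 / (2 * K * r)"
    by (simp add: C_coef_def gam_def d K_def)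
  ultimately have "0 < C_coef W"
    by linarith
  with K01 show "0 < K_coef W" "K_coef W < 1" "0 < C_coef W"
    by (simp_all add: K_def)
qed

text \<open>
  The density stays above \<open>K\<rho>\<close>; replacing it by \<open>K\<rho>\<close> in the kinetic energy bounds the internal
  energy from below by \<open>C + Bt - At\<^sup>2\<close>.
\<close>

lemma source_step_admissible:
  assumes W: "W \<in> admissible" and A: "A_coef W Th g \<noteq> 0"
    and t: "0 < t" "t < 2 * t_source W Th g"
  shows "W + t *\<^sub>R (grav_source W g + Th) \<in> admissible"
proof -
  define r m E u where "r = W $ 1" "m = W $ 2" "E = W $ 3" "u = vel W"
  note d = this
  define K A B C where "K = K_coef W" "A = A_coef W Th g" "B = B_coef W Th g" "C = C_coef W"
  note D = this
  define s where "s = sqrt (B\<^sup>2 + 4 * A * C)"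
  have r: "0 < r" and m: "m = r * u"
    using W by (auto simp: d admissible_def dens_def vel_def mom_def)
  have K: "0 < K" "K < 1" "0 < C"
    using K_coef_bounds[OF W] by (simp_all add: D)
  have "0 \<le> A"
    using K r by (simp add: D(2) A_coef_def D(1)[symmetric] dens_def d(1)[symmetric])
  then have A': "0 < A"
    using A by (simp add: D(2))
  define b where "b = (B + s) / (2 * A)"
  have "t_source W Th g = (if Th $ 1 \<noteq> 0 then min b ((1 - K) * r / \<bar>Th $ 1\<bar>) / 2 else b / 2)"
    by (simp add: t_source_def Let_def D[symmetric] s_def b_def d(1) dens_def)
  then have t1: "t < b" and t2: "Th $ 1 \<noteq> 0 \<Longrightarrow> t < (1 - K) * r / \<bar>Th $ 1\<bar>"
    using t by (auto split: if_splits)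
  define r' m' E' where "r' = r + t * Th $ 1" "m' = m + t * (Th $ 2 - r * g)"
    "E' = E + t * (Th $ 3 - m * g)"
  note d' = this
  have r': "K * r \<le> r'"
  proof (cases "Th $ 1 = 0")
    case False
    then have "t * \<bar>Th $ 1\<bar> < (1 - K) * r"
      using t2 by (simp add: field_simps)
    moreover have "t * (- \<bar>Th $ 1\<bar>) \<le> t * Th $ 1"
      using t(1) by (intro mult_left_mono) auto
    ultimately show ?thesis
      by (simp add: d' algebra_simps)
  qed (use r K in \<open>simp add: d'\<close>)
  have "A * t\<^sup>2 < B * t + C"
    using quadratic_pos_before_root[OF A' K(3), of t B] t t1 by (simp add: s_def b_def)
  \<comment> \<open>\<open>C\<close>, \<open>B\<close> and \<open>- A\<close> are the coefficients
    of E' - m'^2 / (2 K r) as a polynomial in \<open>t\<close>.\<close>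
  moreover have "2 * K * r * (B * t + C - A * t\<^sup>2) = 2 * (K * r) * E' - m'\<^sup>2"
  proof -
    have p: "pres W / (gam - 1) = E - r * u\<^sup>2 / 2"
      by (simp add: pres_def gam_def d dens_def energy_def)
    have "K \<noteq> 0" "r \<noteq> 0"
      using K r by auto
    then have "2 * K * r * C = 2 * K * r * (E - r * u\<^sup>2 / 2) - (1 - K) * m\<^sup>2"
      by (simp add: D(4) C_coef_def D(1)[symmetric] mom_def dens_def d(1,2)[symmetric] p
          right_diff_distrib)
    moreover have "2 * K * r * A = (Th $ 2 - r * g)\<^sup>2"
      using K r by (simp add: D(2) A_coef_def D(1)[symmetric] dens_def d(1)[symmetric])
    moreover have "2 * K * r * B = 2 * K * r * (Th $ 3 - m * g) - 2 * r * (u * Th $ 2 - m * g)"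
      using K r by (simp add: D(3) B_coef_def D(1)[symmetric] mom_def d(2,4)[symmetric] algebra_simps)
    moreover have "2 * K * r * (B * t + C - A * t\<^sup>2)
        = t * (2 * K * r * B) + 2 * K * r * C - t\<^sup>2 * (2 * K * r * A)"
      by (simp add: algebra_simps)
    ultimately have "2 * K * r * (B * t + C - A * t\<^sup>2)
        = t * (2 * K * r * (Th $ 3 - m * g) - 2 * r * (u * Th $ 2 - m * g))
          + (2 * K * r * (E - r * u\<^sup>2 / 2) - (1 - K) * m\<^sup>2) - t\<^sup>2 * (Th $ 2 - r * g)\<^sup>2"
      by (simp only:)
    then show ?thesis
      by (simp add: d' m power2_eq_square algebra_simps)
  qed
  ultimately have *: "m'\<^sup>2 < 2 * (K * r) * E'"
    using K r by (smt (verit) mult_pos_pos)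
  \<comment> \<open>The sign of \<open>E'\<close> is needed before \<open>K * r\<close> may be
    replaced by the larger \<open>r'\<close>.\<close>
  then have "0 < 2 * (K * r) * E'"
    by (rule le_less_trans[OF zero_le_power2])
  moreover have "0 < 2 * (K * r)"
    using K r by simp
  ultimately have "0 < E'"
    by (rule zero_less_mult_pos)
  then have "2 * (K * r) * E' \<le> 2 * r' * E'"
    using r' by simp
  with * have "m'\<^sup>2 < 2 * r' * E'"
    by linarith
  moreover have "0 < r'"
    using r' mult_pos_pos[OF K(1) r] by linarith
  moreover have "(W + t *\<^sub>R (grav_source W g + Th)) $ 1 = r'"
    "(W + t *\<^sub>R (grav_source W g + Th)) $ 2 = m'" "(W + t *\<^sub>R (grav_source W g + Th)) $ 3 = E'"
    by (simp_all add: grav_source_def d' d dens_def mom_def algebra_simps)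
  ultimately show ?thesis
    by (simp add: admissible_iff)
qed

section \<open>Evolution of the cell averages\<close>

text \<open>Weighted deviations from the weighted mean cancel; with total weight 2, the halves in
  \<open>V_bar\<close> make it that mean.\<close>

lemma source_corr_average:
  assumes "(\<Sum>j\<le>k. w j) = 2"
  shows "(\<Sum>j\<le>k. w j *\<^sub>R source_corr k X w a dx FS phix Ue U i j) = 0"
proof -
  define V where "V = V_bar k w U i"
  have "(\<Sum>j\<le>k. w j *\<^sub>R (entropy_var (U i j) - V))
      = (\<Sum>j\<le>k. w j *\<^sub>R entropy_var (U i j)) - (\<Sum>j\<le>k. w j) *\<^sub>R V"
    by (simp add: scaleR_diff_right sum_subtractf scaleR_sum_left)
  also have "(\<Sum>j\<le>k. w j *\<^sub>R entropy_var (U i j)) = 2 *\<^sub>R V"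
    by (simp add: V_def V_bar_def scaleR_sum_right)
  also have "2 *\<^sub>R V - (\<Sum>j\<le>k. w j) *\<^sub>R V = 0"
    using assms by simp
  finally have "sigma k X w a dx FS phix Ue U i *\<^sub>R
      (\<Sum>j\<le>k. w j *\<^sub>R (entropy_var (U i j) - V)) = 0"
    by simp
  then show ?thesis
    by (cases "sigma_denom k w U i = 0")
       (simp_all add: source_corr_def V_def scaleR_sum_right mult.commute)
qed

text \<open>The factor 2 before the difference matrix supplies a second copy of the double sum,
  which is transposed. Symmetry of \<open>G\<close> then brings in summation by parts, and only the
  diagonal entries at the two end nodes survive.\<close>

lemma volume_flux_average:
  fixes G :: "nat \<Rightarrow> nat \<Rightarrow> 'v::real_vector"
  assumes k: "1 \<le> k" and gl: "gauss_lobatto k X w"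
    and sym: "\<And>j l. j \<le> k \<Longrightarrow> l \<le> k \<Longrightarrow> G j l = G l j"
  shows "(\<Sum>j\<le>k. w j *\<^sub>R (\<Sum>l\<le>k. (2 * diff_mat k X j l) *\<^sub>R G j l)) = G k k - G 0 0"
proof -
  define T where "T j l = (w j * diff_mat k X j l) *\<^sub>R G j l" for j l
  have "(\<Sum>j\<le>k. w j *\<^sub>R (\<Sum>l\<le>k. (2 * diff_mat k X j l) *\<^sub>R G j l)) = (\<Sum>j\<le>k. \<Sum>l\<le>k. T j l + T j l)"
    by (simp add: T_def scaleR_sum_right mult_ac flip: scaleR_left_distrib mult_2)
  also have "\<dots> = (\<Sum>j\<le>k. \<Sum>l\<le>k. T j l) + (\<Sum>l\<le>k. \<Sum>j\<le>k. T j l)"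
    by (subst (3) sum.swap) (simp add: sum.distrib)
  also have "\<dots> = (\<Sum>j\<le>k. \<Sum>l\<le>k. T j l + T l j)"
    by (simp add: sum.distrib)
  also have "\<dots> = (\<Sum>j\<le>k. \<Sum>l\<le>k. if j = l then tau k j *\<^sub>R G j j else 0)"
  proof (intro sum.cong refl)
    fix j l assume "j \<in> {..k}" "l \<in> {..k}"
    then have "T j l + T l j = (w j * diff_mat k X j l + w l * diff_mat k X l j) *\<^sub>R G j l"
      using sym[of j l] by (simp add: T_def scaleR_left_distrib)
    also have "\<dots> = (if j = l then tau k j *\<^sub>R G j j else 0)"
      using summation_by_parts[OF k gl, of j l] \<open>j \<in> {..k}\<close> \<open>l \<in> {..k}\<close> by simp
    finally show "T j l + T l j = (if j = l then tau k j *\<^sub>R G j j else 0)" .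
  qed
  also have "\<dots> = (\<Sum>j\<le>k. tau k j *\<^sub>R G j j)"
    by simp
  also have "\<dots> = (\<Sum>j\<in>{0, k}. tau k j *\<^sub>R G j j)"
    by (intro sum.mono_neutral_right) (auto simp: tau_def)
  also have "\<dots> = G k k - G 0 0"
    using k by (simp add: tau_def)
  finally show ?thesis .
qed

text \<open>By consistency of \<open>FS\<close> the volume terms sum to the difference of the exact
  end point fluxes. The surface terms subtract this difference again and leave the numerical fluxes;
  the weights cancel the denominators of the surface terms.\<close>

lemma dg_operator_average:
  assumes k: "1 \<le> k" and gl: "gauss_lobatto k X w"
    and FS: "entropy_conservative_flux FS" and U: "\<forall>j\<le>k. U i j \<in> admissible"
  shows "(\<Sum>j\<le>k. w j *\<^sub>R dg_operator k X w a dx FS phix Ue U i j) =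
      (\<Sum>j\<le>k. w j *\<^sub>R (grav_source (U i j) (phix (node a dx X i j)) + source0 k X a dx FS phix Ue i j))
      - (2 / dx) *\<^sub>R (lf_flux (U i k) (U (i + 1) 0) - lf_flux (U (i - 1) k) (U i 0))"
proof -
  define S where "S j = grav_source (U i j) (phix (node a dx X i j)) + source0 k X a dx FS phix Ue i j" for j
  define R where "R j = source_corr k X w a dx FS phix Ue U i j" for j
  define Q where "Q j = (\<Sum>l\<le>k. (2 * diff_mat k X j l) *\<^sub>R FS (U i j) (U i l))" for j
  define H where "H j = surface_flux k U i j - euler_flux (U i j)" for j
  have w0: "w j \<noteq> 0" if "j \<le> k" for j
    using weight_pos[OF k gl that] by simp
  have "(\<Sum>j\<le>k. w j *\<^sub>R dg_operator k X w a dx FS phix Ue U i j)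
      = (\<Sum>j\<le>k. w j *\<^sub>R S j - w j *\<^sub>R R j - (2 / dx) *\<^sub>R (w j *\<^sub>R Q j) - (2 / dx) *\<^sub>R (tau k j *\<^sub>R H j))"
    by (intro sum.cong refl)
       (simp add: dg_operator_def S_def R_def Q_def H_def w0 scaleR_diff_right scaleR_right_distrib mult_ac)
  also have "\<dots> = (\<Sum>j\<le>k. w j *\<^sub>R S j) - (\<Sum>j\<le>k. w j *\<^sub>R R j)
      - (2 / dx) *\<^sub>R ((\<Sum>j\<le>k. w j *\<^sub>R Q j) + (\<Sum>j\<le>k. tau k j *\<^sub>R H j))"
    by (simp add: sum_subtractf scaleR_sum_right scaleR_right_distrib)
  also have "(\<Sum>j\<le>k. w j *\<^sub>R R j) = 0"
    unfolding R_def by (rule source_corr_average[OF sum_weights[OF k gl]])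
  also have "(\<Sum>j\<le>k. w j *\<^sub>R Q j) = euler_flux (U i k) - euler_flux (U i 0)"
    unfolding Q_def using FS U volume_flux_average[OF k gl, of "\<lambda>j l. FS (U i j) (U i l)"]
    by (simp add: entropy_conservative_flux_def)
  also have "(\<Sum>j\<le>k. tau k j *\<^sub>R H j) = (\<Sum>j\<in>{0, k}. tau k j *\<^sub>R H j)"
    by (intro sum.mono_neutral_right) (auto simp: tau_def)
  also have "\<dots> = H k - H 0"
    using k by (simp add: tau_def)
  also have "euler_flux (U i k) - euler_flux (U i 0) + (H k - H 0)
      = lf_flux (U i k) (U (i + 1) 0) - lf_flux (U (i - 1) k) (U i 0)"
    using k by (simp add: H_def surface_flux_def)
  finally show ?thesis
    by (simp add: S_def)
qed

text \<open>
  One half of the old average carries the sources, the other half the interface fluxes; each half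
  takes a step of length \<open>2 dt\<close>.
\<close>

lemma cell_average_euler_step:
  assumes k: "1 \<le> k" and gl: "gauss_lobatto k X w"
    and FS: "entropy_conservative_flux FS" and U: "\<forall>j\<le>k. U i j \<in> admissible"
  shows "cell_average k w (euler_step k X w a dx FS phix Ue dt U) i =
      (\<Sum>j\<le>k. (w j / 4) *\<^sub>R (U i j + (2 * dt) *\<^sub>R
          (grav_source (U i j) (phix (node a dx X i j)) + source0 k X a dx FS phix Ue i j)))
      + (1 / 2) *\<^sub>R ((\<Sum>j\<in>{0<..<k}. (w j / 2) *\<^sub>R U i j)
          + (((w 0 / 2) *\<^sub>R U i 0 + (2 * dt / dx) *\<^sub>R lf_flux (U (i - 1) k) (U i 0))
           + ((w k / 2) *\<^sub>R U i k - (2 * dt / dx) *\<^sub>R lf_flux (U i k) (U (i + 1) 0))))"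
proof -
  define S where "S j = grav_source (U i j) (phix (node a dx X i j)) + source0 k X a dx FS phix Ue i j" for j
  define F where "F = lf_flux (U i k) (U (i + 1) 0) - lf_flux (U (i - 1) k) (U i 0)"
  have split: "(\<Sum>j\<le>k. (w j / 2) *\<^sub>R U i j)
      = (\<Sum>j\<in>{0<..<k}. (w j / 2) *\<^sub>R U i j) + ((w 0 / 2) *\<^sub>R U i 0 + (w k / 2) *\<^sub>R U i k)"
  proof -
    have "{..k} = {0<..<k} \<union> {0, k}"
      by auto
    then have "(\<Sum>j\<le>k. (w j / 2) *\<^sub>R U i j)
        = (\<Sum>j\<in>{0<..<k}. (w j / 2) *\<^sub>R U i j) + (\<Sum>j\<in>{0, k}. (w j / 2) *\<^sub>R U i j)"
      by (simp only:) (rule sum.union_disjoint, auto)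
    then show ?thesis
      using k by simp
  qed
  have "cell_average k w (euler_step k X w a dx FS phix Ue dt U) i
      = (\<Sum>j\<le>k. (w j / 2) *\<^sub>R U i j)
        + (dt / 2) *\<^sub>R (\<Sum>j\<le>k. w j *\<^sub>R dg_operator k X w a dx FS phix Ue U i j)"
    by (simp add: cell_average_def euler_step_def scaleR_right_distrib sum.distrib scaleR_sum_right mult_ac)
  also have "\<dots> = (\<Sum>j\<le>k. (w j / 2) *\<^sub>R U i j)
      + (dt / 2) *\<^sub>R ((\<Sum>j\<le>k. w j *\<^sub>R S j) - (2 / dx) *\<^sub>R F)"
    using dg_operator_average[where U = U and i = i, OF k gl FS U] by (simp add: S_def F_def)
  also have "\<dots> = ((1 / 2) *\<^sub>R (\<Sum>j\<le>k. (w j / 2) *\<^sub>R U i j) + (dt / 2) *\<^sub>R (\<Sum>j\<le>k. w j *\<^sub>R S j))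
      + (1 / 2) *\<^sub>R ((\<Sum>j\<le>k. (w j / 2) *\<^sub>R U i j) - (2 * dt / dx) *\<^sub>R F)"
    by (simp add: vec_eq_iff field_simps)
  also have "(1 / 2) *\<^sub>R (\<Sum>j\<le>k. (w j / 2) *\<^sub>R U i j) + (dt / 2) *\<^sub>R (\<Sum>j\<le>k. w j *\<^sub>R S j)
      = (\<Sum>j\<le>k. (w j / 4) *\<^sub>R (U i j + (2 * dt) *\<^sub>R S j))"
    by (simp add: scaleR_sum_right scaleR_right_distrib sum.distrib mult_ac)
  also have "(\<Sum>j\<le>k. (w j / 2) *\<^sub>R U i j) - (2 * dt / dx) *\<^sub>R F
      = (\<Sum>j\<in>{0<..<k}. (w j / 2) *\<^sub>R U i j)
          + (((w 0 / 2) *\<^sub>R U i 0 + (2 * dt / dx) *\<^sub>R lf_flux (U (i - 1) k) (U i 0))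
           + ((w k / 2) *\<^sub>R U i k - (2 * dt / dx) *\<^sub>R lf_flux (U i k) (U (i + 1) 0)))"
    unfolding split F_def by (simp add: scaleR_diff_right)
  finally show ?thesis
    by (simp add: S_def)
qed

theorem theorem3p5:
  fixes a b dx dt :: real
    and N k :: nat
    and X w :: "nat \<Rightarrow> real"
    and phi phix :: "real \<Rightarrow> real"
    and Ue :: "real \<Rightarrow> state"
    and FS :: "state \<Rightarrow> state \<Rightarrow> state"
    and U :: "nat \<Rightarrow> nat \<Rightarrow> state"
  assumes "a < b" and "1 \<le> N" and "dx = (b - a) / real N"
    and "1 \<le> k" and "gauss_lobatto k X w"
    and "\<And>x. x \<in> {a..b} \<Longrightarrow> (phi has_real_derivative phix x) (at x within {a..b})"
    and "steady_state a b phix Ue"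
    and "entropy_conservative_flux FS"
    and "\<And>i j. i \<in> {1..N} \<Longrightarrow> j \<le> k \<Longrightarrow> U i j \<in> admissible"
    and "U 0 k \<in> admissible" and "U (N + 1) 0 \<in> admissible"
    and "\<And>i j. i \<in> {1..N} \<Longrightarrow> j \<le> k \<Longrightarrow>
           A_coef (U i j) (source0 k X a dx FS phix Ue i j) (phix (node a dx X i j)) \<noteq> 0"
    and "0 < dt"
    and "dt < min (w 0 / (4 * alpha0 N k U) * dx)
                  (Min ((\<lambda>(i, j). t_source (U i j) (source0 k X a dx FS phix Ue i j)
                                     (phix (node a dx X i j))) ` ({1..N} \<times> {..k})))"
    and "interface_cfl N k w dx dt U"
  shows "\<forall>i\<in>{1..N}. cell_average k w (euler_step k X w a dx FS phix Ue dt U) i \<in> admissible"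
proof
  fix i assume i: "i \<in> {1..N}"
  note k = assms(4) and gl = assms(5)
  have U: "\<forall>j\<le>k. U i j \<in> admissible"
    using assms(9)[OF i] by blast
  have dx: "0 < dx"
    using assms(1-3) by simp
  \<comment> \<open>In the first and last cells the neighbours are the exterior boundary
    states.\<close>
  have neighbours: "U (i - 1) k \<in> admissible" "U (i + 1) 0 \<in> admissible"
    using i assms(9)[of "i - 1" k] assms(9)[of "i + 1" 0] assms(10,11)
    by (cases "i = 1"; cases "i = N"; force)+
  define h where "h = 2 * dt / dx"
  have h: "0 < h"
    using assms(13) dx by (simp add: h_def)
  \<comment> \<open>The interface condition rewritten for the doubled step; \<open>w 0 / 2\<close>
    is the multiple of the end point state available in the flux half.\<close>
  have cfl: "h * lf_alpha (U n k) (U (n + 1) 0) \<le> w 0 / 2"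
    if "n \<le> N" "U n k \<in> admissible" for n
    using assms(15) that dx lf_alpha_pos[OF that(2), of "U (n + 1) 0"]
    by (auto simp: interface_cfl_def h_def field_simps)
  \<comment> \<open>The source half advances by \<open>2 * dt\<close>, which is below twice
    \<open>t_source\<close>.\<close>
  have source: "(w j / 4) *\<^sub>R (U i j + (2 * dt) *\<^sub>R (grav_source (U i j) (phix (node a dx X i j))
      + source0 k X a dx FS phix Ue i j)) \<in> admissible" if j: "j \<le> k" for j
  proof -
    have "dt < t_source (U i j) (source0 k X a dx FS phix Ue i j) (phix (node a dx X i j))"
      using assms(14) i j by (auto simp: Min_gr_iff)
    then show ?thesis
      using weight_pos[OF k gl j] assms(13) i j U
      by (intro admissible_scaleR source_step_admissible assms(12)) auto
  qed
  have interior: "(w j / 2) *\<^sub>R U i j \<in> admissible" if "j \<in> {0<..<k}" for j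
    using that weight_pos[OF k gl, of j] U by (intro admissible_scaleR) auto
  \<comment> \<open>Since \<open>i\<close> is at least 1, interface \<open>i - 1\<close> is the left
    end of cell \<open>i\<close>.\<close>
  have inflow: "(w 0 / 2) *\<^sub>R U i 0 + h *\<^sub>R lf_flux (U (i - 1) k) (U i 0) \<in> admissible"
    using neighbours U h cfl[of "i - 1"] i by (intro lf_flux_inflow_admissible) auto
  \<comment> \<open>The CFL bound is stated with \<open>w 0\<close>, while the right end node
    carries \<open>w k\<close>; the two weights agree.\<close>
  have outflow: "(w k / 2) *\<^sub>R U i k - h *\<^sub>R lf_flux (U i k) (U (i + 1) 0) \<in> admissible"
    using neighbours U h cfl[of i] i weight_sym[OF k gl] by (intro lf_flux_outflow_admissible) auto
  show "cell_average k w (euler_step k X w a dx FS phix Ue dt U) i \<in> admissible"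
    unfolding cell_average_euler_step[where U = U and i = i, OF k gl assms(8) U] h_def[symmetric]
    by (intro admissible_sum_add admissible_scaleR[of "1 / 2"] admissible_add[OF inflow outflow])
       (use source interior in auto)
qed

end
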